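(* Let $X\subset\mathbb{R}^3$ be a bounded domain, $\sigma$ a positive scalar conductivity on $X$, and $u_1,u_2,u_3$ solutions of $\nabla\cdot(\sigma\nabla u_j)=0$ in $X$ such that $\nabla u_1,\nabla u_2,\nabla u_3$ are linearly independent at every point of an open set $\Omega\subset X$. Let $H_{ij}=\sigma\nabla u_i\cdot\nabla u_j$ and $H=(H_{ij})_{1\le i,j\le 3}$, and let $V_{ik}^s$, $V_{ik}^a$ be the vector fields on $\Omega$ built from $H$ as in the context. Let $R=[R_1|R_2|R_3]:\Omega\to SO(3)$ and suppose that $(\sigma,R)$ satisfies on $\Omega$ (repeated indices are summed from $1$ to $3$) $$F:=\tfrac12\nabla\log\sigma=\tfrac16\nabla\log\det H+\tfrac23\langle V_{ij}^s,R_i\rangle R_j$$ and, for all $m,i\in\{1,2,3\}$ (here $i$ is not summed), $$\partial_m R_i=\langle \mathbf e_m,V_{ik}^a\rangle R_k-\langle R_k,\mathbf e_m\rangle V_{ik}^s+\langle V_{jk}^s,R_i\rangle\langle R_k,\mathbf e_m\rangle R_j+\langle F,R_i\rangle \mathbf e_m-\langle R_i,\mathbf e_m\rangle F .$$ Let $q$ be a differentiable quaternion-valued function on $\Omega$ such that $R_j=q\cdot\mathbf e_j\cdot\bar q$ for $j=1,2,3$. Then for every $1\le m\le 3$, $$\partial_m q=\tfrac12\left(q\cdot\mathbf a^m(q)+\mathbf b^m\cdot q\right),\qquad \mathbf b^m:=\left(\tfrac16\nabla\log\det H\right)\times\mathbf e_m,$$ where, writing $T_{\bar q}\mathbf e_m=\mathbf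 t=t_1\mathbf e_1+t_2\mathbf e_2+t_3\mathbf e_3$, the vector $\mathbf a^m=a^m_1\mathbf e_1+a^m_2\mathbf e_2+a^m_3\mathbf e_3$ is given by (summation over the repeated index $k$) $$a_1^m=\langle\mathbf e_m,V_{23}^a\rangle+t_k\big((T_{\bar q}V_{3k}^s)_2-(T_{\bar q}V_{2k}^s)_3\big)+\tfrac23\big((T_{\bar q}V_{2k}^s)_k\,t_3-(T_{\bar q}V_{3k}^s)_k\,t_2\big),$$ $$a_2^m=\langle\mathbf e_m,V_{31}^a\rangle+t_k\big((T_{\bar q}V_{1k}^s)_3-(T_{\bar q}V_{3k}^s)_1\big)+\tfrac23\big((T_{\bar q}V_{3k}^s)_k\,t_1-(T_{\bar q}V_{1k}^s)_k\,t_3\big),$$ $$a_3^m=\langle\mathbf e_m,V_{12}^a\rangle+t_k\big((T_{\bar q}V_{2k}^s)_1-(T_{\bar q}V_{1k}^s)_2\big)+\tfrac23\big((T_{\bar q}V_{1k}^s)_k\,t_2-(T_{\bar q}V_{2k}^s)_k\,t_1\big).$$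
   Context: Quaternions: the real algebra with basis $(1,\mathbf e_1,\mathbf e_2,\mathbf e_3)$, product denoted $\cdot$, with $\mathbf e_i\cdot\mathbf e_i=-1$, $\mathbf e_1\cdot\mathbf e_2=-\mathbf e_2\cdot\mathbf e_1=\mathbf e_3$, $\mathbf e_2\cdot\mathbf e_3=-\mathbf e_3\cdot\mathbf e_2=\mathbf e_1$, $\mathbf e_3\cdot\mathbf e_1=-\mathbf e_1\cdot\mathbf e_3=\mathbf e_2$. The span of $(\mathbf e_1,\mathbf e_2,\mathbf e_3)$ is identified with $\mathbb{R}^3$ with its canonical basis; its elements are called vectors, and $\langle\cdot,\cdot\rangle$, $\times$ are the Euclidean dot and cross products on it. The conjugate of $q=q_0+q_1\mathbf e_1+q_2\mathbf e_2+q_3\mathbf e_3$ is $\bar q=q_0-q_1\mathbf e_1-q_2\mathbf e_2-q_3\mathbf e_3$. For a unit quaternion $q$ and a vector $v$, $T_qv:=q\cdot v\cdot\bar q$ (again a vector), so $T_{\bar q}v=\bar q\cdot v\cdot q$. For a vector $u$, $(u)_i:=\langle u,\mathbf e_i\rangle$. (A $q$ with $R_j=q\cdot\mathbf e_j\cdot\bar q$ and $R\in SO(3)$ is automatically a unit quaternion.) Data: with $d=(H_{11}H_{22}-H_{12}^2)^{1/2}$ and $D=(\det H)^{1/2}$, let $T=(t_{ij})_{1\le i,j\le 3}$ be the lower triangular matrix $$T=\begin{bmatrix}H_{11}^{-1/2}&0&0\\-H_{12}H_{11}^{-1/2}d^{-1}&H_{11}^{1/2}d^{-1}&0\\(H_{12}H_{23}-H_{22}H_{13})(dD)^{-1}&(H_{12}H_{13}-H_{11}H_{23})(dD)^{-1}&dD^{-1}\end{bmatrix},$$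 and let $t^{ij}$ denote the entries of $T^{-1}$. Define the vector fields $V_{ik}:=\sum_{j=1}^3(\nabla t_{ij})\,t^{jk}$, $V_{ik}^s:=\frac12(V_{ik}+V_{ki})$, $V_{ik}^a:=\frac12(V_{ik}-V_{ki})$. (The entries $t_{ij}$ of $T$ are unrelated to the components $t_k$ of $\mathbf t$.) The functions $\sigma$, $u_j$, $R$ are regular enough for all displayed derivatives to exist. *)

theory Defs
  imports "HOL-Analysis.Analysis"
begin

unbundle cross3_syntax

abbreviation \<ee> :: "3 \<Rightarrow> real^3" where
  "\<ee> i \<equiv> axis i 1"

text \<open>
  The pair \<open>(a, v)\<close> stands for \<open>a + v$1 e1 + v$2 e2 + v$3 e3\<close>, so that quaternions inherit
  the Euclidean structure (hence the notion of derivative) of the product space.  The product is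
  the bilinear extension of the multiplication table of the basis; the lemmas below check this.
\<close>

type_synonym quat = "real \<times> (real^3)"

definition qmult :: "quat \<Rightarrow> quat \<Rightarrow> quat"  (infixl \<open>\<odot>\<close> 70) where
  "p \<odot> q = (fst p * fst q - snd p \<bullet> snd q,
            fst p *\<^sub>R snd q + fst q *\<^sub>R snd p + snd p \<times> snd q)"

definition qvec :: "real^3 \<Rightarrow> quat" where
  "qvec v = (0, v)"

definition qcnj :: "quat \<Rightarrow> quat" where
  "qcnj q = (fst q, - snd q)"

lemma bilinear_qmult: "bilinear (\<odot>)"
  unfolding bilinear_def
  by (auto intro!: linearI
      simp: qmult_def prod_eq_iff cross3_simps inner_add_left inner_add_right)

lemma qmult_one: "(1, 0) \<odot> q = q" "q \<odot> (1, 0) = q"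
  by (simp_all add: qmult_def prod_eq_iff cross3_simps)

lemma qmult_basis:
  "qvec (\<ee> i) \<odot> qvec (\<ee> i) = (-1, 0)"
  "qvec (\<ee> 1) \<odot> qvec (\<ee> 2) = qvec (\<ee> 3)" "qvec (\<ee> 2) \<odot> qvec (\<ee> 1) = - qvec (\<ee> 3)"
  "qvec (\<ee> 2) \<odot> qvec (\<ee> 3) = qvec (\<ee> 1)" "qvec (\<ee> 3) \<odot> qvec (\<ee> 2) = - qvec (\<ee> 1)"
  "qvec (\<ee> 3) \<odot> qvec (\<ee> 1) = qvec (\<ee> 2)" "qvec (\<ee> 1) \<odot> qvec (\<ee> 3) = - qvec (\<ee> 2)"
  by (simp_all add: qmult_def qvec_def cross_basis cross_refl inner_axis_axis)

definition T_rot :: "quat \<Rightarrow> real^3 \<Rightarrow> real^3" where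
  "T_rot q v = snd (q \<odot> qvec v \<odot> qcnj q)"

lemma qvec_T_rot: "qvec (T_rot q v) = q \<odot> qvec v \<odot> qcnj q"
  by (simp add: T_rot_def qmult_def qvec_def qcnj_def prod_eq_iff cross3_def inner_vec_def sum_3
      algebra_simps)

definition partial :: "3 \<Rightarrow> (real^3 \<Rightarrow> 'b::real_normed_vector) \<Rightarrow> real^3 \<Rightarrow> 'b" where
  "partial m f x = frechet_derivative f (at x) (\<ee> m)"

definition grad :: "(real^3 \<Rightarrow> real) \<Rightarrow> real^3 \<Rightarrow> real^3" where
  "grad f x = (\<chi> m. partial m f x)"

definition divergence :: "(real^3 \<Rightarrow> real^3) \<Rightarrow> real^3 \<Rightarrow> real" where
  "divergence G x = (\<Sum>m\<in>UNIV. partial m (\<lambda>y. G y $ m) x)"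

lemma GDERIV_grad:
  assumes "f differentiable (at x)"
  shows "GDERIV f x :> grad f x"
proof -
  let ?D = "frechet_derivative f (at x)"
  have D: "(f has_derivative ?D) (at x)"
    using assms frechet_derivative_works by blast
  have lin: "linear ?D"
    using D has_derivative_linear by blast
  have "?D h = h \<bullet> grad f x" for h
  proof -
    have "?D h = ?D (\<Sum>i\<in>UNIV. h $ i *\<^sub>R \<ee> i)"
      by (simp add: basis_expansion flip: scalar_mult_eq_scaleR)
    also have "\<dots> = h \<bullet> grad f x"
      by (simp add: linear_sum[OF lin] linear_cmul[OF lin] inner_vec_def grad_def partial_def)
    finally show ?thesis .
  qed
  then show ?thesis
    using D unfolding gderiv_def by presburger
qed

definition T_mat :: "real^3^3 \<Rightarrow> real^3^3" where
  "T_mat H =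
    (let d = sqrt (H$1$1 * H$2$2 - (H$1$2)\<^sup>2);
         D = sqrt (det H)
     in vector
      [vector [1 / sqrt (H$1$1), 0, 0],
       vector [- H$1$2 / (sqrt (H$1$1) * d), sqrt (H$1$1) / d, 0],
       vector [(H$1$2 * H$2$3 - H$2$2 * H$1$3) / (d * D),
               (H$1$2 * H$1$3 - H$1$1 * H$2$3) / (d * D),
               d / D]])"

definition V :: "(real^3 \<Rightarrow> real^3^3) \<Rightarrow> 3 \<Rightarrow> 3 \<Rightarrow> real^3 \<Rightarrow> real^3" where
  "V H i k x =
    (\<Sum>j\<in>UNIV. (matrix_inv (T_mat (H x)) $ j $ k) *\<^sub>R grad (\<lambda>y. T_mat (H y) $ i $ j) x)"

definition Vs :: "(real^3 \<Rightarrow> real^3^3) \<Rightarrow> 3 \<Rightarrow> 3 \<Rightarrow> real^3 \<Rightarrow> real^3" where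
  "Vs H i k x = (1/2) *\<^sub>R (V H i k x + V H k i x)"

definition Va :: "(real^3 \<Rightarrow> real^3^3) \<Rightarrow> 3 \<Rightarrow> 3 \<Rightarrow> real^3 \<Rightarrow> real^3" where
  "Va H i k x = (1/2) *\<^sub>R (V H i k x - V H k i x)"

text \<open>
  In \<open>a_vec\<close>, \<open>W i k\<close> is the symmetric field with indices \<open>i k\<close> rotated by the conjugate of \<open>q\<close>.
\<close>

definition a_vec :: "(real^3 \<Rightarrow> real^3^3) \<Rightarrow> 3 \<Rightarrow> quat \<Rightarrow> real^3 \<Rightarrow> real^3" where
  "a_vec H m q x =
    (let t = T_rot (qcnj q) (\<ee> m);
         W = (\<lambda>i k. T_rot (qcnj q) (Vs H i k x))
     in vector
      [\<ee> m \<bullet> Va H 2 3 x + (\<Sum>k\<in>UNIV. t$k * (W 3 k $ 2 - W 2 k $ 3))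
         + 2/3 * (\<Sum>k\<in>UNIV. W 2 k $ k * t$3 - W 3 k $ k * t$2),
       \<ee> m \<bullet> Va H 3 1 x + (\<Sum>k\<in>UNIV. t$k * (W 1 k $ 3 - W 3 k $ 1))
         + 2/3 * (\<Sum>k\<in>UNIV. W 3 k $ k * t$1 - W 1 k $ k * t$3),
       \<ee> m \<bullet> Va H 1 2 x + (\<Sum>k\<in>UNIV. t$k * (W 2 k $ 1 - W 1 k $ 2))
         + 2/3 * (\<Sum>k\<in>UNIV. W 1 k $ k * t$2 - W 2 k $ k * t$1)])"

definition b_vec :: "(real^3 \<Rightarrow> real^3^3) \<Rightarrow> 3 \<Rightarrow> real^3 \<Rightarrow> real^3" where
  "b_vec H m x = ((1/6) *\<^sub>R grad (\<lambda>y. ln (det (H y))) x) \<times> \<ee> m"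

end

theory Submission
  imports Defs
begin

text \<open>
  Conjugation by \<open>q\<close> turns the equations for the frame \<open>R\<close> into an equation for its angular velocity.
  Since \<open>R\<close> is a rotation, \<open>q\<close> is a unit quaternion throughout the open set \<open>\<Omega>\<close>, so
  \<open>\<partial>\<^sub>m q\<close> is orthogonal to \<open>q\<close> and hence \<open>\<partial>\<^sub>m q = q \<odot> \<omega>\<close> for a vector \<open>\<omega>\<close>.
  Differentiating \<open>R\<^sub>i = T\<^sub>q e\<^sub>i\<close> gives \<open>\<partial>\<^sub>m R\<^sub>i = T\<^sub>q (2 \<omega> \<times> e\<^sub>i)\<close>, so the coefficients
  \<open>\<langle>\<partial>\<^sub>m R\<^sub>i, R\<^sub>k\<rangle> = 2 \<langle>\<omega> \<times> e\<^sub>i, e\<^sub>k\<rangle>\<close> for \<open>(i, k) = (2, 3), (3, 1), (1, 2)\<close>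
  are the three components of \<open>2 \<omega>\<close>.

  The same coefficients can be read off the given equation for \<open>\<partial>\<^sub>m R\<^sub>i\<close>.  The frame is orthonormal
  and the components of a vector \<open>v\<close> along it are those of \<open>T v\<close>, where \<open>T\<close> is the rotation by
  the conjugate of \<open>q\<close>; thus every term becomes an expression in the components of
  \<open>t = T e\<^sub>m\<close>, of the rotated symmetric fields and of \<open>f = T F\<close>, as computed in
  \<open>frame_equation_component\<close>.  The two terms in \<open>F\<close> contribute \<open>f \<times> t\<close>.
  Inserting the equation for \<open>F\<close> splits \<open>f\<close> into the rotated \<open>\<nabla> log det H / 6\<close>, whose
  contribution to \<open>2 \<omega>\<close> is \<open>T b\<close> with \<open>b = b\<^sup>m\<close> because rotations preserve cross products, and the terms
  with factor \<open>2/3\<close> in \<open>a\<^sup>m\<close>.  So \<open>2 \<omega> = a\<^sup>m + T b\<close>, and \<open>q \<odot> T b = b \<odot> q\<close> finishes.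
\<close>

section \<open>Quaternion algebra\<close>

lemma qmult_assoc: "p \<odot> q \<odot> r = p \<odot> (q \<odot> r)"
  by (simp add: qmult_def prod_eq_iff cross3_def inner_vec_def sum_3 vec_eq_iff forall_3 algebra_simps)

lemma qcnj_qmult: "qcnj (p \<odot> q) = qcnj q \<odot> qcnj p"
  by (simp add: qmult_def qcnj_def prod_eq_iff cross3_def inner_vec_def sum_3 vec_eq_iff forall_3
      algebra_simps)

lemma qcnj_qcnj [simp]: "qcnj (qcnj q) = q"
  by (simp add: qcnj_def)

lemma qmult_qcnj: "q \<odot> qcnj q = (q \<bullet> q, 0)" "qcnj q \<odot> q = (q \<bullet> q, 0)"
  by (simp_all add: qmult_def qcnj_def prod_eq_iff inner_prod_def cross_refl)

lemma fst_qcnj_qmult: "fst (qcnj p \<odot> q) = p \<bullet> q"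
  by (simp add: qmult_def qcnj_def inner_prod_def)

lemma inner_qmult_self: "(p \<odot> q) \<bullet> (p \<odot> q) = (p \<bullet> p) * (q \<bullet> q)"
  by (simp add: qmult_def inner_prod_def cross3_def inner_vec_def sum_3 algebra_simps power2_eq_square)

lemma inner_qcnj_self [simp]: "qcnj q \<bullet> qcnj q = q \<bullet> q"
  by (simp add: qcnj_def inner_prod_def)

lemma bounded_bilinear_qmult: "bounded_bilinear (\<odot>)"
  using bilinear_qmult bilinear_conv_bounded_bilinear by blast

lemma bounded_linear_qcnj: "bounded_linear qcnj"
  unfolding qcnj_def
  by (intro bounded_linear_Pair bounded_linear_minus bounded_linear_fst bounded_linear_snd)

section \<open>Rotations by unit quaternions\<close>

lemma inner_T_rot: "v \<bullet> T_rot q w = T_rot (qcnj q) v \<bullet> w"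
  by (simp add: T_rot_def qmult_def qvec_def qcnj_def cross3_def inner_vec_def sum_3 algebra_simps)

lemma inner_T_rot_axis: "v \<bullet> T_rot q (\<ee> k) = T_rot (qcnj q) v $ k"
  by (simp add: inner_T_rot inner_axis)

lemma T_rot_T_rot_qcnj:
  assumes "q \<bullet> q = 1"
  shows "T_rot (qcnj q) (T_rot q v) = v"
proof -
  have "qvec (T_rot (qcnj q) (T_rot q v)) = (qcnj q \<odot> q) \<odot> qvec v \<odot> (qcnj q \<odot> q)"
    by (simp add: qvec_T_rot qmult_assoc)
  then show ?thesis
    using assms by (simp add: qmult_qcnj qmult_one qvec_def)
qed

text \<open>The cross product is half the commutator of vectors, which conjugation by a unit preserves.\<close>

lemma qvec_cross: "2 *\<^sub>R qvec (v \<times> w) = qvec v \<odot> qvec w - qvec w \<odot> qvec v"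
  by (simp add: qvec_def qmult_def prod_eq_iff inner_commute cross3_def vec_eq_iff forall_3)

lemma T_rot_cross:
  assumes "q \<bullet> q = 1"
  shows "T_rot q (v \<times> w) = T_rot q v \<times> T_rot q w"
proof -
  note diff = bounded_bilinear.diff_left[OF bounded_bilinear_qmult]
    bounded_bilinear.diff_right[OF bounded_bilinear_qmult]
  note scaleR = bounded_bilinear.scaleR_left[OF bounded_bilinear_qmult]
    bounded_bilinear.scaleR_right[OF bounded_bilinear_qmult]
  have mult: "qvec (T_rot q a) \<odot> qvec (T_rot q b) = q \<odot> (qvec a \<odot> qvec b) \<odot> qcnj q" for a b
  proof -
    have "qvec (T_rot q a) \<odot> qvec (T_rot q b)
        = q \<odot> qvec a \<odot> (qcnj q \<odot> q) \<odot> qvec b \<odot> qcnj q"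
      by (simp add: qvec_T_rot qmult_assoc)
    then show ?thesis
      using assms by (simp add: qmult_qcnj qmult_one qmult_assoc)
  qed
  have "2 *\<^sub>R qvec (T_rot q v \<times> T_rot q w) = q \<odot> (2 *\<^sub>R qvec (v \<times> w)) \<odot> qcnj q"
    by (simp only: qvec_cross mult diff)
  also have "\<dots> = 2 *\<^sub>R qvec (T_rot q (v \<times> w))"
    by (simp only: qvec_T_rot scaleR)
  finally show ?thesis
    by (simp add: qvec_def)
qed

text \<open>The norm is multiplicative, so \<open>q \<odot> w \<odot> qcnj q\<close> has length \<open>\<bar>q\<bar>\<^sup>2 \<bar>w\<bar>\<close>.\<close>

lemma unit_quat_if_rotates_to_unit:
  assumes "qvec v = q \<odot> qvec w \<odot> qcnj q" "v \<bullet> v = 1" "w \<bullet> w = 1"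
  shows "q \<bullet> q = 1"
proof -
  have "qvec v \<bullet> qvec v = (q \<bullet> q)\<^sup>2 * (qvec w \<bullet> qvec w)"
    unfolding assms(1) by (simp add: inner_qmult_self power2_eq_square)
  then have "(q \<bullet> q)\<^sup>2 = 1"
    using assms by (simp add: qvec_def inner_prod_def)
  then show ?thesis
    using inner_ge_zero[of q] by (auto simp: power2_eq_1_iff)
qed

section \<open>Derivatives of a frame carried by a unit quaternion\<close>

text \<open>
  The real part of \<open>qcnj q \<odot> q'\<close> is half the derivative of \<open>\<bar>q\<bar>\<^sup>2\<close>, so it vanishes; what remains is
  the body angular velocity, up to a factor \<open>2\<close>.
\<close>

lemma unit_quat_derivative:
  assumes \<Omega>: "open \<Omega>" "x \<in> \<Omega>"
    and q: "(q has_derivative q') (at x)"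
    and unit: "\<And>y. y \<in> \<Omega> \<Longrightarrow> q y \<bullet> q y = 1"
  obtains w where "q' h = q x \<odot> qvec w"
proof -
  have "((\<lambda>y. q y \<bullet> q y) has_derivative (\<lambda>h. q x \<bullet> q' h + q' h \<bullet> q x)) (at x)"
    by (intro has_derivative_inner q)
  moreover have "((\<lambda>y. q y \<bullet> q y) has_derivative (\<lambda>h. 0)) (at x)"
    by (rule has_derivative_transform_within_open[OF has_derivative_const \<Omega>]) (simp add: unit)
  ultimately have "(\<lambda>h. q x \<bullet> q' h + q' h \<bullet> q x) = (\<lambda>h. 0)"
    by (rule has_derivative_unique)
  then have "q x \<bullet> q' h = 0"
    by (simp add: inner_commute fun_eq_iff)
  then have "qcnj (q x) \<odot> q' h = qvec (snd (qcnj (q x) \<odot> q' h))"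
    by (simp add: qvec_def prod_eq_iff fst_qcnj_qmult)
  moreover have "q x \<odot> (qcnj (q x) \<odot> q' h) = q' h"
    using unit[OF \<Omega>(2)] by (simp add: qmult_qcnj qmult_one flip: qmult_assoc)
  ultimately show ?thesis
    using that by metis
qed

text \<open>
  Both outer factors of \<open>q \<odot> v \<odot> qcnj q\<close> vary.  Since \<open>qcnj w = - w\<close> for the vector \<open>w\<close>, their
  contributions combine to the commutator of \<open>w\<close> and \<open>v\<close>, which is \<open>2 (w \<times> v)\<close>.
\<close>

lemma derivative_T_rot:
  assumes q: "(q has_derivative q') (at x)" and w: "q' h = q x \<odot> qvec w"
  shows "frechet_derivative (\<lambda>y. T_rot (q y) v) (at x) h = T_rot (q x) (2 *\<^sub>R (w \<times> v))"
proof -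
  note mult = bounded_bilinear.FDERIV[OF bounded_bilinear_qmult]
  have qv: "((\<lambda>y. q y \<odot> qvec v) has_derivative (\<lambda>h. q' h \<odot> qvec v)) (at x)"
    by (rule bounded_linear.has_derivative
        [OF bounded_bilinear.bounded_linear_left[OF bounded_bilinear_qmult] q])
  have qc: "((\<lambda>y. qcnj (q y)) has_derivative (\<lambda>h. qcnj (q' h))) (at x)"
    by (rule bounded_linear.has_derivative[OF bounded_linear_qcnj q])
  have D: "((\<lambda>y. T_rot (q y) v) has_derivative
      (\<lambda>h. snd (q x \<odot> qvec v \<odot> qcnj (q' h) + q' h \<odot> qvec v \<odot> qcnj (q x)))) (at x)"
    unfolding T_rot_def by (rule has_derivative_snd[OF mult[OF qv qc]])
  have "frechet_derivative (\<lambda>y. T_rot (q y) v) (at x) h =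
      snd (q x \<odot> qvec v \<odot> qcnj (q' h) + q' h \<odot> qvec v \<odot> qcnj (q x))"
    by (rule fun_cong[OF frechet_derivative_at[OF D, symmetric]])
  also have "\<dots> = snd (q x \<odot> (qvec v \<odot> qcnj (qvec w) + qvec w \<odot> qvec v) \<odot> qcnj (q x))"
    by (simp only: w qcnj_qmult qmult_assoc bounded_bilinear.add_left[OF bounded_bilinear_qmult]
        bounded_bilinear.add_right[OF bounded_bilinear_qmult])
  also have "qvec v \<odot> qcnj (qvec w) + qvec w \<odot> qvec v = qvec (2 *\<^sub>R (w \<times> v))"
    by (simp add: qvec_def qcnj_def qmult_def prod_eq_iff inner_commute cross3_def vec_eq_iff forall_3)
  finally show ?thesis
    by (simp add: T_rot_def)
qed

section \<open>The angular velocity of the reconstructed frame\<close>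

text \<open>
  Taking the inner product of the evolution equation of \<open>R i\<close> with \<open>R k\<close>: orthonormality collapses the
  sums over frame vectors, and inner products with the frame become components of rotated vectors.
  The three choices \<open>(2, 3)\<close>, \<open>(3, 1)\<close>, \<open>(1, 2)\<close> of \<open>(i, k)\<close> give the components of \<open>2 w\<close>.
\<close>

lemma frame_equation_component:
  fixes A :: "3 \<Rightarrow> 3 \<Rightarrow> real" and S :: "3 \<Rightarrow> 3 \<Rightarrow> real^3" and e F w :: "real^3" and q :: quat
  defines "R \<equiv> \<lambda>k. T_rot q (\<ee> k)" and "T \<equiv> T_rot (qcnj q)"
  assumes q: "q \<bullet> q = 1"
    and eq: "T_rot q (2 *\<^sub>R (w \<times> \<ee> i)) =
        (\<Sum>k\<in>UNIV. A i k *\<^sub>R R k)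
        - (\<Sum>k\<in>UNIV. (R k \<bullet> e) *\<^sub>R S i k)
        + (\<Sum>j\<in>UNIV. \<Sum>k\<in>UNIV. ((S j k \<bullet> R i) * (R k \<bullet> e)) *\<^sub>R R j)
        + (F \<bullet> R i) *\<^sub>R e
        - (R i \<bullet> e) *\<^sub>R F"
  shows "2 * (w \<times> \<ee> i) $ k =
      A i k + (\<Sum>l\<in>UNIV. T e $ l * (T (S k l) $ i - T (S i l) $ k))
      + (T F $ i * T e $ k - T e $ i * T F $ k)"
proof -
  have R: "v \<bullet> R j = T v $ j" "R j \<bullet> v = T v $ j" for v j
    by (simp_all add: R_def T_def inner_T_rot_axis inner_commute[of "T_rot q (\<ee> j)"])
  have TR: "T (R j) = \<ee> j" for j
    by (simp add: R_def T_def T_rot_T_rot_qcnj q)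
  have delta: "(\<Sum>j\<in>UNIV. c j * \<ee> j $ k) = c k" for c :: "3 \<Rightarrow> real"
    by (simp add: axis_def if_distrib cong: if_cong)
  have "2 * (w \<times> \<ee> i) $ k = T_rot q (2 *\<^sub>R (w \<times> \<ee> i)) \<bullet> R k"
    by (simp add: R(1)) (simp add: T_def T_rot_T_rot_qcnj q)
  also have "\<dots> = (\<Sum>j\<in>UNIV. A i j * \<ee> j $ k)
        - (\<Sum>l\<in>UNIV. T e $ l * T (S i l) $ k)
        + (\<Sum>j\<in>UNIV. (\<Sum>l\<in>UNIV. T (S j l) $ i * T e $ l) * \<ee> j $ k)
        + T F $ i * T e $ k - T e $ i * T F $ k"
    unfolding eq
    by (simp only: inner_add_left inner_diff_left inner_sum_left inner_scaleR_left)
      (simp only: R TR sum_distrib_right)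
  also have "\<dots> = A i k + (\<Sum>l\<in>UNIV. T e $ l * (T (S k l) $ i - T (S i l) $ k))
      + (T F $ i * T e $ k - T e $ i * T F $ k)"
    by (simp only: delta) (simp add: right_diff_distrib sum_subtractf mult.commute)
  finally show ?thesis .
qed

lemma Vs_commute: "Vs H i k x = Vs H k i x"
  by (simp add: Vs_def add.commute)

theorem theorem3p2:
  fixes X \<Omega> :: "(real^3) set"
    and \<sigma> :: "real^3 \<Rightarrow> real"
    and u :: "3 \<Rightarrow> real^3 \<Rightarrow> real"
    and H R :: "real^3 \<Rightarrow> real^3^3"
    and F :: "real^3 \<Rightarrow> real^3"
    and q :: "real^3 \<Rightarrow> quat"
  assumes X: "open X" "connected X" "X \<noteq> {}" "bounded X"
    and \<Omega>: "open \<Omega>" "\<Omega> \<subseteq> X"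
    and \<sigma>_pos: "\<And>x. x \<in> X \<Longrightarrow> \<sigma> x > 0"
    and \<sigma>_diff: "\<And>x. x \<in> \<Omega> \<Longrightarrow> \<sigma> differentiable (at x)"
    and u_diff: "\<And>j x. x \<in> X \<Longrightarrow> u j differentiable (at x)"
    and flux_diff: "\<And>j x. x \<in> X \<Longrightarrow> (\<lambda>y. \<sigma> y *\<^sub>R grad (u j) y) differentiable (at x)"
    and u_sol: "\<And>j x. x \<in> X \<Longrightarrow> divergence (\<lambda>y. \<sigma> y *\<^sub>R grad (u j) y) x = 0"
    and u_indep: "\<And>x. x \<in> \<Omega> \<Longrightarrow>
        inj (\<lambda>j. grad (u j) x) \<and> independent (range (\<lambda>j. grad (u j) x))"
    and H: "\<And>x. x \<in> X \<Longrightarrow> H x = (\<chi> i j. \<sigma> x * (grad (u i) x \<bullet> grad (u j) x))"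
    and R_SO3: "\<And>x. x \<in> \<Omega> \<Longrightarrow> rotation_matrix (R x)"
    and R_diff: "\<And>x. x \<in> \<Omega> \<Longrightarrow> R differentiable (at x)"
    and F: "\<And>x. x \<in> \<Omega> \<Longrightarrow> F x = (1/2) *\<^sub>R grad (\<lambda>y. ln (\<sigma> y)) x"
    and \<sigma>_eq: "\<And>x. x \<in> \<Omega> \<Longrightarrow> F x =
        (1/6) *\<^sub>R grad (\<lambda>y. ln (det (H y))) x
        + (2/3) *\<^sub>R (\<Sum>i\<in>UNIV. \<Sum>j\<in>UNIV. (Vs H i j x \<bullet> column i (R x)) *\<^sub>R column j (R x))"
    and R_eq: "\<And>m i x. x \<in> \<Omega> \<Longrightarrow> partial m (\<lambda>y. column i (R y)) x =
        (\<Sum>k\<in>UNIV. (\<ee> m \<bullet> Va H i k x) *\<^sub>R column k (R x))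
        - (\<Sum>k\<in>UNIV. (column k (R x) \<bullet> \<ee> m) *\<^sub>R Vs H i k x)
        + (\<Sum>j\<in>UNIV. \<Sum>k\<in>UNIV.
            ((Vs H j k x \<bullet> column i (R x)) * (column k (R x) \<bullet> \<ee> m)) *\<^sub>R column j (R x))
        + (F x \<bullet> column i (R x)) *\<^sub>R \<ee> m
        - (column i (R x) \<bullet> \<ee> m) *\<^sub>R F x"
    and q_diff: "\<And>x. x \<in> \<Omega> \<Longrightarrow> q differentiable (at x)"
    and q_R: "\<And>j x. x \<in> \<Omega> \<Longrightarrow> qvec (column j (R x)) = q x \<odot> qvec (\<ee> j) \<odot> qcnj (q x)"
  shows "\<forall>x\<in>\<Omega>. \<forall>m. partial m q x =
      (1/2) *\<^sub>R (q x \<odot> qvec (a_vec H m (q x) x) + qvec (b_vec H m x) \<odot> q x)"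
proof (intro ballI allI)
  fix x m
  assume x: "x \<in> \<Omega>"
  define Q where "Q = q x"
  define T where "T = T_rot (qcnj Q)"
  define t where "t = T (\<ee> m)"
  define G where "G = (1/6) *\<^sub>R grad (\<lambda>y. ln (det (H y))) x"
  define W where "W = (\<lambda>i k. T (Vs H i k x))"
  have col: "column j (R y) = T_rot (q y) (\<ee> j)" if "y \<in> \<Omega>" for y j
    using q_R[OF that, of j] by (metis qvec_T_rot qvec_def snd_conv)
  have unit: "q y \<bullet> q y = 1" if "y \<in> \<Omega>" for y
  proof (rule unit_quat_if_rotates_to_unit[OF q_R[OF that, of 1]])
    show "column 1 (R y) \<bullet> column 1 (R y) = 1"
      using R_SO3[OF that]
      by (simp add: rotation_matrix_def orthogonal_matrix_orthonormal_columns dot_square_norm)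
  qed (simp add: inner_axis_axis)
  have Q: "Q \<bullet> Q = 1" "qcnj Q \<bullet> qcnj Q = 1"
    using unit[OF x] by (simp_all add: Q_def)
  have q': "(q has_derivative frechet_derivative q (at x)) (at x)"
    using q_diff[OF x] frechet_derivative_works by blast
  obtain w where w: "partial m q x = Q \<odot> qvec w"
    unfolding partial_def Q_def using unit_quat_derivative[OF \<Omega>(1) x q' unit] by blast
  have dR: "partial m (\<lambda>y. column i (R y)) x = T_rot Q (2 *\<^sub>R (w \<times> \<ee> i))" for i
  proof -
    have "frechet_derivative (\<lambda>y. column i (R y)) (at x)
        = frechet_derivative (\<lambda>y. T_rot (q y) (\<ee> i)) (at x)"
      \<comment> \<open>Both sides choose from the same set of derivatives, as the functions agree near \<open>x\<close>.\<close>
      unfolding frechet_derivative_def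
      by (intro arg_cong[of _ _ Eps] ext iffI;
          erule has_derivative_transform_within_open[OF _ \<Omega>(1) x]) (simp_all add: col)
    then show ?thesis
      using derivative_T_rot[OF q', of "\<ee> m" w "\<ee> i"] w by (simp add: partial_def Q_def)
  qed
  have comp: "2 * (w \<times> \<ee> i) $ k = \<ee> m \<bullet> Va H i k x
      + (\<Sum>l\<in>UNIV. t $ l * (W k l $ i - W i l $ k))
      + (T (F x) $ i * t $ k - t $ i * T (F x) $ k)" for i k
    unfolding T_def t_def W_def
    by (rule frame_equation_component[where A = "\<lambda>i k. \<ee> m \<bullet> Va H i k x", OF Q(1)])
      (use R_eq[OF x, of m i] in \<open>simp only: dR col[OF x] Q_def\<close>)
  \<comment> \<open>The inner product of the equation for \<open>F\<close> with the frame vector \<open>R\<^sub>j\<close>.\<close>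
  have TF: "T (F x) $ j = T G $ j + 2/3 * (\<Sum>i\<in>UNIV. W j i $ i)" for j
  proof -
    have Rj: "v \<bullet> column j (R x) = T v $ j" for v j
      by (simp add: col[OF x] inner_T_rot_axis T_def Q_def)
    have TR: "T (column l (R x)) = \<ee> l" for l
      using T_rot_T_rot_qcnj[OF Q(1), of "\<ee> l"] by (simp add: col[OF x] T_def Q_def)
    have "T (F x) $ j = F x \<bullet> column j (R x)"
      by (simp add: Rj)
    also have "\<dots> = T G $ j + 2/3 * (\<Sum>i\<in>UNIV. \<Sum>l\<in>UNIV. W i l $ i * \<ee> l $ j)"
      unfolding \<sigma>_eq[OF x] G_def[symmetric]
      by (simp only: inner_add_left inner_sum_left inner_scaleR_left)
        (simp only: Rj TR W_def)
    also have "(\<Sum>i\<in>UNIV. \<Sum>l\<in>UNIV. W i l $ i * \<ee> l $ j) = (\<Sum>i\<in>UNIV. W j i $ i)"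
      by (simp add: axis_def if_distrib W_def Vs_commute[of H j] cong: if_cong)
    finally show ?thesis .
  qed
  have b: "T (b_vec H m x) = T G \<times> t"
    unfolding b_vec_def G_def[symmetric] T_def t_def by (rule T_rot_cross[OF Q(2)])
  have "2 *\<^sub>R w = a_vec H m Q x + T (b_vec H m x)"
  proof -
    have cyc: "w $ 1 = (w \<times> \<ee> 2) $ 3" "w $ 2 = (w \<times> \<ee> 3) $ 1" "w $ 3 = (w \<times> \<ee> 1) $ 2"
      by (simp_all add: cross3_def axis_def)
    have a: "a_vec H m Q x = vector
      [\<ee> m \<bullet> Va H 2 3 x + (\<Sum>k\<in>UNIV. t$k * (W 3 k $ 2 - W 2 k $ 3))
         + 2/3 * (\<Sum>k\<in>UNIV. W 2 k $ k * t$3 - W 3 k $ k * t$2),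
       \<ee> m \<bullet> Va H 3 1 x + (\<Sum>k\<in>UNIV. t$k * (W 1 k $ 3 - W 3 k $ 1))
         + 2/3 * (\<Sum>k\<in>UNIV. W 3 k $ k * t$1 - W 1 k $ k * t$3),
       \<ee> m \<bullet> Va H 1 2 x + (\<Sum>k\<in>UNIV. t$k * (W 2 k $ 1 - W 1 k $ 2))
         + 2/3 * (\<Sum>k\<in>UNIV. W 1 k $ k * t$2 - W 2 k $ k * t$1)]"
      by (simp add: a_vec_def Let_def t_def W_def T_def)
    have "2 * (w $ 1) = (a_vec H m Q x + T G \<times> t) $ 1"
      unfolding cyc comp TF a
      by (simp add: cross3_def sum_subtractf flip: sum_distrib_right) (simp add: field_simps)
    moreover have "2 * (w $ 2) = (a_vec H m Q x + T G \<times> t) $ 2"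
      unfolding cyc comp TF a
      by (simp add: cross3_def sum_subtractf flip: sum_distrib_right) (simp add: field_simps)
    moreover have "2 * (w $ 3) = (a_vec H m Q x + T G \<times> t) $ 3"
      unfolding cyc comp TF a
      by (simp add: cross3_def sum_subtractf flip: sum_distrib_right) (simp add: field_simps)
    ultimately show ?thesis
      unfolding b by (simp add: vec_eq_iff forall_3)
  qed
  then have "w = (1/2) *\<^sub>R (a_vec H m Q x + T (b_vec H m x))"
    by (metis (no_types) scaleR_scaleR scaleR_one nonzero_eq_divide_eq zero_neq_numeral)
  then have "qvec w = (1/2) *\<^sub>R (qvec (a_vec H m Q x) + qvec (T (b_vec H m x)))"
    by (simp add: qvec_def)
  then have "partial m q x = (1/2) *\<^sub>R (Q \<odot> qvec (a_vec H m Q x) + Q \<odot> qvec (T (b_vec H m x)))"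
    unfolding w by (simp only: bounded_bilinear.scaleR_right[OF bounded_bilinear_qmult]
        bounded_bilinear.add_right[OF bounded_bilinear_qmult])
  also have "Q \<odot> qvec (T (b_vec H m x)) = Q \<odot> qcnj Q \<odot> qvec (b_vec H m x) \<odot> Q"
    by (simp add: T_def qvec_T_rot qmult_assoc)
  also have "\<dots> = qvec (b_vec H m x) \<odot> Q"
    by (simp add: qmult_qcnj Q qmult_one)
  finally show "partial m q x =
      (1/2) *\<^sub>R (q x \<odot> qvec (a_vec H m (q x) x) + qvec (b_vec H m x) \<odot> q x)"
    unfolding Q_def .
qed

end
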